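(* Let $X$ be a real normed space and let $\mathcal C,\mathcal K\subset X$ be co-radiant sets such that $d_{\mathcal C}d_{\mathcal K}>0$, $\mathcal K$ is regular, $\operatorname{cl\,co}(\mathcal C)\cap\operatorname{int}(\mathcal K)\ne\varnothing$, and $(\operatorname{cone}(\mathcal C),\operatorname{cone}(\mathcal K))$ verifies the SSP. Let $0<\alpha_1<\alpha_2<1$, $f\in S_{X^*}$, $\lambda>0$ and $\eta_0>0$ be such that, for every $0<\theta<1$, every $\eta\in(0,\theta\eta_0)$ and every $\alpha\in(\alpha_1,\alpha_2)$, $$f(y')-\alpha\|y'\|<\lambda\theta<\lambda<f(y)-\alpha\|y\|\qquad\forall y'\in X\setminus\operatorname{int}(\mathcal K(\eta)),\ \forall y\in\operatorname{cl\,co}(\mathcal C).$$ Fix $\alpha\in(\alpha_1,\alpha_2)$ and set $G_\alpha(y):=(\lambda-f(y)+\alpha\|y\|)_+$ and $R_\alpha(y):=\frac{\eta_0}{\lambda}G_\alpha(y)$ for $y\in X$. Let $A\subset X\setminus\{0_X\}$ be nonempty, let $\Phi:A\times A\to\mathbb R$, and for $y\in A$ define $$E_\Phi(y):=\sup_{z\in A}[-\Phi(y,z)]_+,\qquad M_{\alpha,\Phi}(y):=\max\{E_\Phi(y),R_\alpha(y)\}.$$ Let $\varepsilon\ge 0$. If $y\in A$ satisfies $M_{\alpha,\Phi}(y)\le\varepsilon$, then $y$ is an $\varepsilon$-approximate radially feasible equilibrium point. Consequently, if $(y_n)\subset A$ satisfies $M_{\alpha,\Phi}(y_n)\to 0$,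 then $$E_\Phi(y_n)\to 0\qquad\text{and}\qquad\bigl(\eta_0-\delta_{\mathcal K}(y_n)\bigr)_+\to 0.$$
   Context: $X$ is a real normed space, $S_X$ its unit sphere, $B_X^\circ$ its open unit ball, $X^*$ its topological dual, $S_{X^*}$ the unit sphere of $X^*$ for the dual norm; $\operatorname{cl},\operatorname{int},\operatorname{bd},\operatorname{co}$ denote closure, interior, boundary, convex hull, and $\operatorname{cl\,co}$ the closed convex hull; $t_+=[t]_+:=\max\{t,0\}$. A cone is a nonempty $C\subset X$ with $\alpha C\subset C$ for all $\alpha\ge 0$; cones are assumed nontrivial ($\{0_X\}\subsetneq C\subset X$) unless otherwise stated. $\operatorname{cone}(A):=\{\lambda a:\lambda\ge 0,\ a\in A\}$. Approximate equilibrium: for $\varepsilon\ge 0$, a point $y\in A$ is an $\varepsilon$-approximate radially feasible equilibrium point if $\Phi(y,z)\ge-\varepsilon$ for all $z\in A$ and $\delta_{\mathcal K}(y)\ge\eta_0-\varepsilon$. SSP: a pair of cones $(C,K)$ verifies the strict separation property (SSP) if $0_X\notin\operatorname{cl}\bigl(\operatorname{co}(C\cap S_X)-\operatorname{co}((\operatorname{bd}K\cap S_X)\cup\{0_X\})\bigr)$. Co-radiant set: $\mathcal K\subset X$ with $\lambda x\in\mathcal K$ for all $x\in\mathcal K$, $\lambda\ge 1$; co-radiant sets are assumed nonempty with $0_X\notin\mathcal K$. For $\eta>0$, $\mathcal K(\eta):=\eta\mathcal K$. Norm-base: for $t>0$, $\mathcal K\cap tS_X$ is a norm-base of $\mathcal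 K$ if for every $x\in\mathcal K$ there exist $y\in\mathcal K\cap tS_X$ and $\lambda>0$ with $x=\lambda y$; $\mathcal K$ admits a norm-base if this holds for some $t>0$. Interior reductions: for a cone $K$ and $\varepsilon>0$, $K^{-\varepsilon}:=K\setminus\bigl(\operatorname{cone}((\operatorname{bd}K\cap S_X)+\varepsilon B_X^\circ)\setminus\{0_X\}\bigr)$. For co-radiant $\mathcal K$, $\mathcal K^{-\varepsilon}:=\mathcal K\cap(\operatorname{cone}(\mathcal K))^{-\varepsilon}$. $\mathcal K$ is regular if, for every $\varepsilon>0$ with $\mathcal K^{-\varepsilon}\neq\varnothing$, the set $\mathcal K^{-\varepsilon}$ admits a norm-base. Radial profile: $\rho_{\mathcal K}:S_X\to[0,+\infty]$, $\rho_{\mathcal K}(v):=\inf\{\lambda>0:\lambda v\in\mathcal K\}$ with $\inf\varnothing=+\infty$; $\operatorname{dom}(\rho_{\mathcal K}):=\{v\in S_X:\rho_{\mathcal K}(v)<+\infty\}$; $d_{\mathcal K}:=\inf_{v\in\operatorname{dom}(\rho_{\mathcal K})}\rho_{\mathcal K}(v)$. Radial depth: $\delta_{\mathcal K}:X\setminus\{0_X\}\to[0,+\infty]$, $\delta_{\mathcal K}(y):=\sup\{\eta>0:\ y\in\mathcal K(\eta)\}$ with $\sup\varnothing=0$. *)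

theory Defs
  imports "HOL-Analysis.Analysis"
begin

text \<open>
  Dictionary: the space \<open>X\<close> is a type of class \<open>real_normed_vector\<close>; \<open>t S\<^sub>X\<close> (for \<open>t > 0\<close>) is
  \<open>sphere 0 t\<close>; the open ball of radius \<open>\<epsilon>\<close> is \<open>ball 0 \<epsilon>\<close>; \<open>bd\<close> is \<open>frontier\<close>; the dual is
  \<open>'a \<Rightarrow>\<^sub>L real\<close> with its operator norm; and the conic hull
  \<open>cone(A) = {\<lambda> a | \<lambda> \<ge> 0, a \<in> A}\<close> is \<open>cone hull A\<close> (see \<open>cone_hull_expl\<close>).
  Quantities with values in \<open>[0,+\<infinity>]\<close> are taken in \<open>ereal\<close>.
\<close>

definition coradiant :: "'a::real_normed_vector set \<Rightarrow> bool" where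
  "coradiant K \<longleftrightarrow> K \<noteq> {} \<and> 0 \<notin> K \<and> (\<forall>x\<in>K. \<forall>l\<ge>1. l *\<^sub>R x \<in> K)"

definition scaled :: "'a::real_normed_vector set \<Rightarrow> real \<Rightarrow> 'a set" where
  "scaled K \<eta> = (\<lambda>x. \<eta> *\<^sub>R x) ` K"

text \<open>
  The strict separation property, for a pair of cones. The difference of the two convex hulls is
  the Minkowski difference, not the set difference. Below it is only applied to conic hulls of
  co-radiant sets; these are cones different from \<open>{0}\<close>.
\<close>
definition SSP :: "'a::real_normed_vector set \<Rightarrow> 'a set \<Rightarrow> bool" where
  "SSP C K \<longleftrightarrow>
     0 \<notin> closure {x - y | x y. x \<in> convex hull (C \<inter> sphere 0 1) \<and>
                               y \<in> convex hull ((frontier K \<inter> sphere 0 1) \<union> {0})}"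

definition is_norm_base :: "'a::real_normed_vector set \<Rightarrow> real \<Rightarrow> bool" where
  "is_norm_base K t \<longleftrightarrow> (\<forall>x\<in>K. \<exists>y\<in>K \<inter> sphere 0 t. \<exists>l>0. x = l *\<^sub>R y)"

definition admits_norm_base :: "'a::real_normed_vector set \<Rightarrow> bool" where
  "admits_norm_base K \<longleftrightarrow> (\<exists>t>0. is_norm_base K t)"

definition cone_reduction :: "'a::real_normed_vector set \<Rightarrow> real \<Rightarrow> 'a set" where
  "cone_reduction K \<epsilon> =
     K - (cone hull {b + u | b u. b \<in> frontier K \<inter> sphere 0 1 \<and> u \<in> ball 0 \<epsilon>} - {0})"

definition coradiant_reduction :: "'a::real_normed_vector set \<Rightarrow> real \<Rightarrow> 'a set" where
  "coradiant_reduction K \<epsilon> = K \<inter> cone_reduction (cone hull K) \<epsilon>"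

definition regular_coradiant :: "'a::real_normed_vector set \<Rightarrow> bool" where
  "regular_coradiant K \<longleftrightarrow>
     (\<forall>\<epsilon>>0. coradiant_reduction K \<epsilon> \<noteq> {} \<longrightarrow> admits_norm_base (coradiant_reduction K \<epsilon>))"

text \<open>In \<open>ereal\<close> the infimum of the empty set is \<open>\<infinity>\<close>, as required here.\<close>
definition radial_profile :: "'a::real_normed_vector set \<Rightarrow> 'a \<Rightarrow> ereal" where
  "radial_profile K v = (INF l\<in>{l::real. l > 0 \<and> l *\<^sub>R v \<in> K}. ereal l)"

definition radial_dom :: "'a::real_normed_vector set \<Rightarrow> 'a set" where
  "radial_dom K = {v \<in> sphere 0 1. radial_profile K v < \<infinity>}"

definition radial_inf :: "'a::real_normed_vector set \<Rightarrow> ereal" where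
  "radial_inf K = (INF v\<in>radial_dom K. radial_profile K v)"

text \<open>The convention here is \<open>sup \<emptyset> = 0\<close>, whereas the supremum of the empty set in \<open>ereal\<close>
  is \<open>-\<infinity>\<close>.\<close>
definition radial_depth :: "'a::real_normed_vector set \<Rightarrow> 'a \<Rightarrow> ereal" where
  "radial_depth K y =
     (let H = {\<eta>::real. \<eta> > 0 \<and> y \<in> scaled K \<eta>} in if H = {} then 0 else (SUP \<eta>\<in>H. ereal \<eta>))"

text \<open>Bifunctions on \<open>A \<times> A\<close> are curried total functions of which only the values on \<open>A\<close> are used.\<close>
definition approx_radial_equilibrium ::
  "'a::real_normed_vector set \<Rightarrow> 'a set \<Rightarrow> ('a \<Rightarrow> 'a \<Rightarrow> real) \<Rightarrow> real \<Rightarrow> real \<Rightarrow> 'a \<Rightarrow> bool" where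
  "approx_radial_equilibrium K A \<Phi> \<eta>0 \<epsilon> y \<longleftrightarrow>
     y \<in> A \<and> (\<forall>z\<in>A. \<Phi> y z \<ge> - \<epsilon>) \<and> radial_depth K y \<ge> ereal (\<eta>0 - \<epsilon>)"

definition gap_fun :: "('a::real_normed_vector \<Rightarrow>\<^sub>L real) \<Rightarrow> real \<Rightarrow> real \<Rightarrow> 'a \<Rightarrow> real" where
  "gap_fun f l \<alpha> y = max (l - f y + \<alpha> * norm y) 0"

definition residual_fun ::
  "('a::real_normed_vector \<Rightarrow>\<^sub>L real) \<Rightarrow> real \<Rightarrow> real \<Rightarrow> real \<Rightarrow> 'a \<Rightarrow> real" where
  "residual_fun f l \<eta>0 \<alpha> y = \<eta>0 / l * gap_fun f l \<alpha> y"

definition equilibrium_error :: "'a set \<Rightarrow> ('a \<Rightarrow> 'a \<Rightarrow> real) \<Rightarrow> 'a \<Rightarrow> ereal" where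
  "equilibrium_error A \<Phi> y = (SUP z\<in>A. ereal (max (- \<Phi> y z) 0))"

definition merit_fun ::
  "('a::real_normed_vector \<Rightarrow>\<^sub>L real) \<Rightarrow> real \<Rightarrow> real \<Rightarrow> real \<Rightarrow> 'a set \<Rightarrow> ('a \<Rightarrow> 'a \<Rightarrow> real) \<Rightarrow> 'a \<Rightarrow> ereal"
  where
  "merit_fun f l \<eta>0 \<alpha> A \<Phi> y =
     max (equilibrium_error A \<Phi> y) (ereal (residual_fun f l \<eta>0 \<alpha> y))"

end

theory Submission
  imports Defs
begin

text \<open>
  The separating functional \<open>g y = f y - \<alpha> * norm y\<close> detects radial feasibility level by level: a
  point outside \<open>interior (scaled K \<eta>)\<close> has \<open>g y < l * \<theta>\<close> whenever \<open>\<eta> < \<theta> * \<eta>0\<close>. Read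
  contrapositively, \<open>g y \<ge> l * \<theta>\<close> puts \<open>y\<close> in \<open>scaled K \<eta>\<close> for all \<open>\<eta> < \<theta> * \<eta>0\<close>, so the
  radial depth of \<open>y\<close> is at least \<open>\<theta> * \<eta>0\<close>. The residual \<open>R y\<close> is normalised so that
  \<open>\<theta> * \<eta>0 = \<eta>0 - R y\<close> for the supremum \<open>\<theta>\<close> of the levels detected in this way, as long as
  this is positive; otherwise the bound below only says that the depth is nonnegative. Hence the
  depth deficit \<open>\<eta>0 - radial_depth K y\<close> never exceeds the residual (\<open>radial_depth_ge_residual\<close>).

  The merit function dominates both the equilibrium error and the residual. The first part of the
  theorem is therefore a comparison of each component with \<open>\<epsilon>\<close>, and the second part squeezes
  the two nonnegative errors between \<open>0\<close> and the merit function.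
\<close>

lemma radial_depth_upper:
  assumes "\<eta> > 0" and "y \<in> scaled K \<eta>"
  shows "ereal \<eta> \<le> radial_depth K y"
proof -
  have "{\<eta>::real. \<eta> > 0 \<and> y \<in> scaled K \<eta>} \<noteq> {}"
    using assms by auto
  then show ?thesis
    using assms by (auto simp: radial_depth_def intro: SUP_upper)
qed

lemma radial_depth_nonneg: "0 \<le> radial_depth K y"
proof (cases "\<exists>\<eta>>0. y \<in> scaled K \<eta>")
  case True
  then obtain \<eta> where "\<eta> > 0" "y \<in> scaled K \<eta>" by blast
  then show ?thesis
    by (intro order_trans[OF _ radial_depth_upper[of \<eta>]]) auto
next
  case False
  then show ?thesis by (simp add: radial_depth_def)
qed

text \<open>
  Each \<open>\<eta>\<close> with \<open>0 < \<eta> < \<eta>0 - R y\<close> is a feasible level: between \<open>\<eta> / \<eta>0\<close> and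
  \<open>1 - R y / \<eta>0\<close> there is room for a \<open>\<theta>\<close>, and for it the value of the separating functional at
  \<open>y\<close> is too large for \<open>y\<close> to lie outside \<open>scaled K \<eta>\<close>. The supremum over these levels need not
  be attained, whence the argument by density.
\<close>
lemma radial_depth_ge_residual:
  fixes f :: "'a::real_normed_vector \<Rightarrow>\<^sub>L real"
  assumes "l > 0" and "\<eta>0 > 0"
    and sep: "\<And>\<theta> \<eta> y'. \<lbrakk>0 < \<theta>; \<theta> < 1; 0 < \<eta>; \<eta> < \<theta> * \<eta>0; y' \<notin> scaled K \<eta>\<rbrakk>
      \<Longrightarrow> f y' - \<alpha> * norm y' < l * \<theta>"
  shows "ereal (\<eta>0 - residual_fun f l \<eta>0 \<alpha> y) \<le> radial_depth K y"
proof (rule dense_le)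
  fix x :: ereal
  assume x: "x < ereal (\<eta>0 - residual_fun f l \<eta>0 \<alpha> y)"
  show "x \<le> radial_depth K y"
  proof (cases "x \<le> 0")
    case True
    then show ?thesis using radial_depth_nonneg order_trans by blast
  next
    case False
    with x obtain \<eta> where \<eta>: "x = ereal \<eta>" "\<eta> > 0"
      by (cases x) auto
    define s where "s = 1 - gap_fun f l \<alpha> y / l"
    have "\<eta> < s * \<eta>0"
      using x \<eta> by (simp add: s_def residual_fun_def field_simps)
    then have "\<eta> / \<eta>0 < s"
      using \<open>\<eta>0 > 0\<close> by (simp add: field_simps)
    then obtain \<theta> where \<theta>: "\<eta> / \<eta>0 < \<theta>" "\<theta> < s"
      using dense by blast
    have "s \<le> 1"
      using \<open>l > 0\<close> by (simp add: s_def gap_fun_def)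
    have "0 < \<eta> / \<eta>0"
      using \<open>\<eta> > 0\<close> \<open>\<eta>0 > 0\<close> by simp
    with \<theta> \<open>s \<le> 1\<close> have "0 < \<theta>" "\<theta> < 1"
      by linarith+
    have "\<eta> < \<theta> * \<eta>0"
      using \<theta>(1) \<open>\<eta>0 > 0\<close> by (simp add: field_simps)
    have "l * s = l - gap_fun f l \<alpha> y"
      using \<open>l > 0\<close> by (simp add: s_def field_simps)
    then have "l * s \<le> f y - \<alpha> * norm y"
      by (simp add: gap_fun_def)
    moreover have "l * \<theta> < l * s"
      using \<theta>(2) \<open>l > 0\<close> by simp
    ultimately have "\<not> f y - \<alpha> * norm y < l * \<theta>"
      by linarith
    with sep[OF \<open>0 < \<theta>\<close> \<open>\<theta> < 1\<close> \<open>\<eta> > 0\<close> \<open>\<eta> < \<theta> * \<eta>0\<close>] have "y \<in> scaled K \<eta>"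
      by blast
    then show ?thesis
      using radial_depth_upper \<eta> by blast
  qed
qed

lemma equilibrium_error_nonneg:
  assumes "A \<noteq> {}"
  shows "0 \<le> equilibrium_error A \<Phi> y"
proof -
  obtain z where "z \<in> A" using assms by blast
  then show ?thesis
    unfolding equilibrium_error_def by (intro SUP_upper2[of z]) (auto simp: max_def)
qed

theorem proposition7p10:
  fixes C K A :: "'a::real_normed_vector set"
    and f :: "'a \<Rightarrow>\<^sub>L real"
    and \<alpha>1 \<alpha>2 \<alpha> l \<eta>0 :: real
    and \<Phi> :: "'a \<Rightarrow> 'a \<Rightarrow> real"
  assumes "coradiant C" and "coradiant K"
    and "radial_inf C * radial_inf K > 0"
    and "regular_coradiant K"
    and "closure (convex hull C) \<inter> interior K \<noteq> {}"
    and "SSP (cone hull C) (cone hull K)"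
    and "0 < \<alpha>1" and "\<alpha>1 < \<alpha>2" and "\<alpha>2 < 1"
    and "norm f = 1" and "l > 0" and "\<eta>0 > 0"
    and "\<forall>\<theta>\<in>{0<..<1}. \<forall>\<eta>\<in>{0<..<\<theta> * \<eta>0}. \<forall>a\<in>{\<alpha>1<..<\<alpha>2}.
           \<forall>y'\<in>UNIV - interior (scaled K \<eta>). \<forall>y\<in>closure (convex hull C).
             f y' - a * norm y' < l * \<theta> \<and> l * \<theta> < l \<and> l < f y - a * norm y"
    and "\<alpha> \<in> {\<alpha>1<..<\<alpha>2}"
    and "A \<noteq> {}" and "A \<subseteq> UNIV - {0}"
  shows "(\<forall>\<epsilon>\<ge>0. \<forall>y\<in>A. merit_fun f l \<eta>0 \<alpha> A \<Phi> y \<le> ereal \<epsilon> \<longrightarrow>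
            approx_radial_equilibrium K A \<Phi> \<eta>0 \<epsilon> y) \<and>
         (\<forall>ys :: nat \<Rightarrow> 'a. range ys \<subseteq> A \<and> (\<lambda>n. merit_fun f l \<eta>0 \<alpha> A \<Phi> (ys n)) \<longlonglongrightarrow> 0 \<longrightarrow>
            (\<lambda>n. equilibrium_error A \<Phi> (ys n)) \<longlonglongrightarrow> 0 \<and>
            (\<lambda>n. max (ereal \<eta>0 - radial_depth K (ys n)) 0) \<longlonglongrightarrow> 0)"
proof -
  \<comment> \<open>The separation inequality is quantified over both sides at once; any point of
    \<open>closure (convex hull C)\<close> extracts its half about the complement of \<open>scaled K \<eta>\<close>.\<close>
  obtain c where c: "c \<in> closure (convex hull C)"
    using assms(5) by blast
  have sep: "f y' - \<alpha> * norm y' < l * \<theta>"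
    if "0 < \<theta>" "\<theta> < 1" "0 < \<eta>" "\<eta> < \<theta> * \<eta>0" "y' \<notin> scaled K \<eta>" for \<theta> \<eta> y'
  proof -
    have "y' \<in> UNIV - interior (scaled K \<eta>)"
      using that(5) interior_subset by blast
    moreover have "\<theta> \<in> {0<..<1}" "\<eta> \<in> {0<..<\<theta> * \<eta>0}"
      using that by auto
    ultimately show ?thesis
      using assms(13,14) c by blast
  qed
  let ?M = "merit_fun f l \<eta>0 \<alpha> A \<Phi>"
  let ?E = "equilibrium_error A \<Phi>"
  let ?R = "residual_fun f l \<eta>0 \<alpha>"
  let ?D = "\<lambda>y. max (ereal \<eta>0 - radial_depth K y) 0"
  have depth: "ereal (\<eta>0 - ?R y) \<le> radial_depth K y" for y
    using assms(11,12) by (rule radial_depth_ge_residual) (rule sep)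
  have E_le: "?E y \<le> ?M y" and R_le: "ereal (?R y) \<le> ?M y" for y
    by (simp_all add: merit_fun_def)
  have R_nonneg: "0 \<le> ?R y" for y
    using assms(11,12) by (simp add: residual_fun_def gap_fun_def)
  have D_le: "?D y \<le> ?M y" for y
  proof -
    have "?D y \<le> ereal (?R y)"
      using depth[of y] R_nonneg[of y] by (cases "radial_depth K y") auto
    then show ?thesis using R_le order_trans by blast
  qed
  have "approx_radial_equilibrium K A \<Phi> \<eta>0 \<epsilon> y"
    if "y \<in> A" and M: "?M y \<le> ereal \<epsilon>" for \<epsilon> y
  proof -
    have "- \<epsilon> \<le> \<Phi> y z" if "z \<in> A" for z
    proof -
      have "ereal (max (- \<Phi> y z) 0) \<le> ?E y"
        unfolding equilibrium_error_def using that by (rule SUP_upper)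
      also have "\<dots> \<le> ereal \<epsilon>"
        using E_le M order_trans by blast
      finally show ?thesis by simp
    qed
    moreover have "?R y \<le> \<epsilon>"
      using order_trans[OF R_le M] by simp
    then have "ereal (\<eta>0 - \<epsilon>) \<le> radial_depth K y"
      using depth[of y] by (intro order_trans[OF _ depth]) simp
    ultimately show ?thesis
      using \<open>y \<in> A\<close> by (simp add: approx_radial_equilibrium_def)
  qed
  moreover have "(\<lambda>n. ?E (ys n)) \<longlonglongrightarrow> 0 \<and> (\<lambda>n. ?D (ys n)) \<longlonglongrightarrow> 0"
    if "(\<lambda>n. ?M (ys n)) \<longlonglongrightarrow> 0" for ys :: "nat \<Rightarrow> 'a"
  proof
    show "(\<lambda>n. ?E (ys n)) \<longlonglongrightarrow> 0"
      by (rule tendsto_sandwich[OF _ _ tendsto_const that])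
        (simp_all add: E_le equilibrium_error_nonneg[OF assms(15)])
    show "(\<lambda>n. ?D (ys n)) \<longlonglongrightarrow> 0"
      by (rule tendsto_sandwich[OF _ _ tendsto_const that])
        (simp_all only: D_le max.cobounded2 eventually_True)
  qed
  ultimately show ?thesis by blast
qed

end
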